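(* Let $Z$ be a countably generated discrete coarse space which is coarsely contractible. Then the Rips complex $\mathcal{P}_Z$ is $\sigma$-contractible, i.e. it admits a $\sigma$-contraction to a point.
   Context: **Coarse spaces.** A coarse structure on a set $X$ is a collection $\mathcal E$ of subsets of $X\times X$ (entourages) containing the diagonal and all finite subsets, and closed under subsets, inverses, finite unions and compositions $E_1\circ E_2=\{(x,z): \exists y,\ (x,y)\in E_1,(y,z)\in E_2\}$. A set $B\subset X$ is bounded if $B\times B\in\mathcal E$. A coarse space is a locally compact (Hausdorff) space with a coarse structure such that some neighborhood of the diagonal is an entourage and every bounded set is relatively compact; it is discrete if its topology is discrete (so bounded sets are finite). It is countably generated if there is an increasing sequence $(E_n)_{n\in\mathbb N}$ of entourages such that every entourage is contained in some $E_n$. The product coarse structure on $X\times Y$ consists of the subsets of sets $\{(x_1,y_1,x_2,y_2):(x_1,x_2)\in E_X,(y_1,y_2)\in E_Y\}$ with $E_X,E_Y$ entourages. **Coarse contraction.** $X$ is coarsely contractible if for some $pt\in X$ there is a Borel map $H:X\times\mathbb N\to X$ (with $\mathbb N$ carrying its metric coarse structure) such that $H\times H$ maps entourages of $X\times\mathbb N$ to entourages of $X$; $H(x,0)=x$ for all $x$; for every bounded $B\subset X$ there is $N_B\in\mathbb N$ with $H(x,n)=pt$ for all $x\in B$, $n\ge N_B$; and $H(pt,n)=pt$ for all $n$. **$\sigma$-locally compact spaces.** A $\sigma$-locally compact space is a set $\mathcal X=\bigcup_{n\in\mathbb N}X_n$ with an increasing sequence of subsets, each $X_n$ locally compact Hausdorff,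 closed in $X_m$ and carrying the subspace topology for $n\le m$. A $\sigma$-contraction of $\mathcal X$ to $pt\in\mathcal X$ is a map $H:\mathcal X\times[0,1]\to\mathcal X$ with $H(x,0)=x$ for all $x$, $H(\mathcal X\times\{1\}\cup\{pt\}\times[0,1])=\{pt\}$, and such that for each $n$ there is $m\ge n$ with $H(X_n\times[0,1])\subset X_m$ and the restriction $X_n\times[0,1]\to X_m$ continuous. **Rips complex.** Fix an increasing sequence $(E_n)$ of entourages generating the coarse structure of $Z$. $\mathcal P_Z$ is the set of finitely supported probability measures on $Z$, a simplicial complex with vertices the Dirac measures, with the corresponding topology. It is the $\sigma$-locally compact space $\mathcal P_Z=\bigcup_nP_{Z,n}$ where $P_{Z,n}=\{\mu\in\mathcal P_Z:\operatorname{supp}\mu\times\operatorname{supp}\mu\subset E_n\}$ (locally finite subcomplexes). *)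

theory Defs
  imports "HOL-Probability.Probability"
begin

section \<open>Coarse spaces\<close>

locale coarse_structure =
  fixes X :: "'a set" and \<E> :: "('a \<times> 'a) set set"
  assumes entourage_subset: "e \<in> \<E> \<Longrightarrow> e \<subseteq> X \<times> X"
    and diagonal: "Id_on X \<in> \<E>"
    and finite_entourage: "finite e \<Longrightarrow> e \<subseteq> X \<times> X \<Longrightarrow> e \<in> \<E>"
    and subset_closed: "e \<in> \<E> \<Longrightarrow> d \<subseteq> e \<Longrightarrow> d \<in> \<E>"
    and converse_closed: "e \<in> \<E> \<Longrightarrow> e\<inverse> \<in> \<E>"
    and union_closed: "e \<in> \<E> \<Longrightarrow> d \<in> \<E> \<Longrightarrow> e \<union> d \<in> \<E>"
    and comp_closed: "e \<in> \<E> \<Longrightarrow> d \<in> \<E> \<Longrightarrow> e O d \<in> \<E>"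

definition coarsely_bounded :: "'a set \<Rightarrow> ('a \<times> 'a) set set \<Rightarrow> 'a set \<Rightarrow> bool" where
  "coarsely_bounded X \<E> B \<longleftrightarrow> B \<subseteq> X \<and> B \<times> B \<in> \<E>"

locale coarse_space = coarse_structure "topspace T" \<E>
  for T :: "'a topology" and \<E> :: "('a \<times> 'a) set set" +
  assumes locally_compact: "locally_compact_space T"
    and Hausdorff: "Hausdorff_space T"
    and diagonal_neighborhood:
      "\<exists>N\<in>\<E>. \<exists>U. openin (prod_topology T T) U \<and> Id_on (topspace T) \<subseteq> U \<and> U \<subseteq> N"
    and bounded_relatively_compact:
      "coarsely_bounded (topspace T) \<E> B \<Longrightarrow> compactin T (T closure_of B)"

locale discrete_coarse_space = coarse_space T \<E>
  for T :: "'a topology" and \<E> :: "('a \<times> 'a) set set" +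
  assumes discrete: "T = discrete_topology (topspace T)"

definition generating_sequence :: "('a \<times> 'a) set set \<Rightarrow> (nat \<Rightarrow> ('a \<times> 'a) set) \<Rightarrow> bool" where
  "generating_sequence \<E> E \<longleftrightarrow>
     incseq E \<and> (\<forall>n. E n \<in> \<E>) \<and> (\<forall>e\<in>\<E>. \<exists>n. e \<subseteq> E n)"

definition countably_generated :: "('a \<times> 'a) set set \<Rightarrow> bool" where
  "countably_generated \<E> \<longleftrightarrow> (\<exists>E. generating_sequence \<E> E)"

text \<open>The metric coarse structure of \<open>\<nat>\<close>.\<close>

definition nat_coarse_structure :: "(nat \<times> nat) set set" where
  "nat_coarse_structure = {e. \<exists>r. \<forall>(m, n)\<in>e. dist (real m) (real n) \<le> r}"

definition product_coarse_structure ::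
  "('a \<times> 'a) set set \<Rightarrow> ('b \<times> 'b) set set \<Rightarrow> (('a \<times> 'b) \<times> ('a \<times> 'b)) set set" where
  "product_coarse_structure \<E>X \<E>Y =
     {e. \<exists>a\<in>\<E>X. \<exists>b\<in>\<E>Y. e \<subseteq> {((x1, y1), (x2, y2)). (x1, x2) \<in> a \<and> (y1, y2) \<in> b}}"


section \<open>Coarse contractibility\<close>

definition borel_measure_of :: "'a topology \<Rightarrow> 'a measure" where
  "borel_measure_of T = sigma (topspace T) {U. openin T U}"

text \<open>The values of \<open>H\<close> outside \<open>topspace T \<times> UNIV\<close> are irrelevant.\<close>

definition coarse_contraction ::
  "'a topology \<Rightarrow> ('a \<times> 'a) set set \<Rightarrow> 'a \<Rightarrow> ('a \<times> nat \<Rightarrow> 'a) \<Rightarrow> bool" where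
  "coarse_contraction T \<E> pt H \<longleftrightarrow>
     pt \<in> topspace T \<and>
     H \<in> borel_measure_of (prod_topology T (discrete_topology UNIV)) \<rightarrow>\<^sub>M borel_measure_of T \<and>
     (\<forall>e\<in>product_coarse_structure \<E> nat_coarse_structure. map_prod H H ` e \<in> \<E>) \<and>
     (\<forall>x\<in>topspace T. H (x, 0) = x) \<and>
     (\<forall>B. coarsely_bounded (topspace T) \<E> B \<longrightarrow> (\<exists>N. \<forall>x\<in>B. \<forall>n\<ge>N. H (x, n) = pt)) \<and>
     (\<forall>n. H (pt, n) = pt)"

definition coarsely_contractible :: "'a topology \<Rightarrow> ('a \<times> 'a) set set \<Rightarrow> bool" where
  "coarsely_contractible T \<E> \<longleftrightarrow> (\<exists>pt H. coarse_contraction T \<E> pt H)"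


section \<open>\<open>\<sigma>\<close>-locally compact spaces\<close>

text \<open>A \<open>\<sigma>\<close>-locally compact space is given by the sequence of topologies of its pieces;
  the underlying set is \<open>\<Union>n. topspace (X n)\<close>.\<close>

definition sigma_carrier :: "(nat \<Rightarrow> 'a topology) \<Rightarrow> 'a set" where
  "sigma_carrier X = (\<Union>n. topspace (X n))"

definition sigma_locally_compact :: "(nat \<Rightarrow> 'a topology) \<Rightarrow> bool" where
  "sigma_locally_compact X \<longleftrightarrow>
     (\<forall>n. locally_compact_space (X n) \<and> Hausdorff_space (X n)) \<and>
     (\<forall>n m. n \<le> m \<longrightarrow> closedin (X m) (topspace (X n)) \<and> X n = subtopology (X m) (topspace (X n)))"

definition sigma_contraction ::
  "(nat \<Rightarrow> 'a topology) \<Rightarrow> 'a \<Rightarrow> ('a \<times> real \<Rightarrow> 'a) \<Rightarrow> bool" where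
  "sigma_contraction X pt H \<longleftrightarrow>
     pt \<in> sigma_carrier X \<and>
     H \<in> sigma_carrier X \<times> {0..1} \<rightarrow> sigma_carrier X \<and>
     (\<forall>x\<in>sigma_carrier X. H (x, 0) = x) \<and>
     H ` (sigma_carrier X \<times> {1} \<union> {pt} \<times> {0..1}) = {pt} \<and>
     (\<forall>n. \<exists>m\<ge>n. H ` (topspace (X n) \<times> {0..1}) \<subseteq> topspace (X m) \<and>
        continuous_map (prod_topology (X n) (top_of_set {0..1})) (X m) H)"

definition sigma_contractible :: "(nat \<Rightarrow> 'a topology) \<Rightarrow> bool" where
  "sigma_contractible X \<longleftrightarrow> sigma_locally_compact X \<and> (\<exists>pt H. sigma_contraction X pt H)"


section \<open>The Rips complex\<close>

text \<open>Probability measures are of type \<open>pmf\<close>, with support \<open>set_pmf\<close>.\<close>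

definition finite_prob :: "'a set \<Rightarrow> 'a pmf set" where
  "finite_prob Z = {\<mu>. finite (set_pmf \<mu>) \<and> set_pmf \<mu> \<subseteq> Z}"

text \<open>The closed simplex spanned by the Dirac measures at the points of a finite set \<open>F\<close>,
  topologized by the barycentric coordinates \<open>x \<mapsto> pmf \<mu> x\<close>.\<close>

definition simplex_topology :: "'a set \<Rightarrow> 'a pmf topology" where
  "simplex_topology F = pullback_topology {\<mu>. set_pmf \<mu> \<subseteq> F} pmf euclidean"

text \<open>The simplicial complex of all finitely supported probability measures on \<open>Z\<close>
  with the weak topology: a set is open iff its intersection with every closed
  simplex is open in that simplex.\<close>

definition prob_complex :: "'a set \<Rightarrow> 'a pmf topology" where
  "prob_complex Z = topology (\<lambda>U. U \<subseteq> finite_prob Z \<and>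
     (\<forall>F. finite F \<and> F \<subseteq> Z \<longrightarrow> openin (simplex_topology F) (U \<inter> {\<mu>. set_pmf \<mu> \<subseteq> F})))"

definition rips_complex ::
  "'a set \<Rightarrow> (nat \<Rightarrow> ('a \<times> 'a) set) \<Rightarrow> nat \<Rightarrow> 'a pmf topology" where
  "rips_complex Z E n =
     subtopology (prob_complex Z) {\<mu> \<in> finite_prob Z. set_pmf \<mu> \<times> set_pmf \<mu> \<subseteq> E n}"


section \<open>Well-definedness of the Rips complex\<close>

lemma topspace_simplex_topology [simp]: "topspace (simplex_topology F) = {\<mu>. set_pmf \<mu> \<subseteq> F}"
  by (simp add: simplex_topology_def topspace_pullback_topology)

lemma openin_prob_complex:
  "openin (prob_complex Z) U \<longleftrightarrow> U \<subseteq> finite_prob Z \<and>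
     (\<forall>F. finite F \<and> F \<subseteq> Z \<longrightarrow> openin (simplex_topology F) (U \<inter> {\<mu>. set_pmf \<mu> \<subseteq> F}))"
proof -
  define P where "P U \<longleftrightarrow> U \<subseteq> finite_prob Z \<and>
     (\<forall>F. finite F \<and> F \<subseteq> Z \<longrightarrow> openin (simplex_topology F) (U \<inter> {\<mu>. set_pmf \<mu> \<subseteq> F}))" for U
  have "istopology P"
    unfolding istopology_def
  proof (intro conjI allI impI)
    fix S T assume P: "P S" "P T"
    have "openin (simplex_topology F) (S \<inter> T \<inter> {\<mu>. set_pmf \<mu> \<subseteq> F})"
      if "finite F \<and> F \<subseteq> Z" for F
    proof -
      have "S \<inter> T \<inter> {\<mu>. set_pmf \<mu> \<subseteq> F} =
          (S \<inter> {\<mu>. set_pmf \<mu> \<subseteq> F}) \<inter> (T \<inter> {\<mu>. set_pmf \<mu> \<subseteq> F})"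
        by blast
      then show ?thesis
        using P that by (simp only: P_def openin_Int)
    qed
    with P show "P (S \<inter> T)" by (simp add: P_def le_infI1)
  next
    fix \<K> assume P: "\<forall>K\<in>\<K>. P K"
    have "openin (simplex_topology F) (\<Union>\<K> \<inter> {\<mu>. set_pmf \<mu> \<subseteq> F})"
      if "finite F \<and> F \<subseteq> Z" for F
    proof -
      have "openin (simplex_topology F) (\<Union>K\<in>\<K>. K \<inter> {\<mu>. set_pmf \<mu> \<subseteq> F})"
        by (rule openin_Union) (use P that in \<open>force simp only: P_def image_iff\<close>)
      then show ?thesis by (simp only: Int_Union2)
    qed
    with P show "P (\<Union>\<K>)" by (simp add: P_def Union_least)
  qed
  then have "openin (topology P) = P" by (rule topology_inverse')
  moreover have "prob_complex Z = topology P"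
    unfolding prob_complex_def P_def ..
  ultimately show ?thesis by (simp only: P_def)
qed

lemma topspace_prob_complex [simp]: "topspace (prob_complex Z) = finite_prob Z"
proof -
  have "openin (simplex_topology F) (finite_prob Z \<inter> {\<mu>. set_pmf \<mu> \<subseteq> F})"
    if "finite F" "F \<subseteq> Z" for F
  proof -
    have "finite_prob Z \<inter> {\<mu>. set_pmf \<mu> \<subseteq> F} = topspace (simplex_topology F)"
      using that by (auto simp: finite_prob_def intro: finite_subset)
    then show ?thesis by (metis openin_topspace)
  qed
  then have "openin (prob_complex Z) (finite_prob Z)"
    by (simp add: openin_prob_complex)
  then show ?thesis
    by (meson openin_prob_complex openin_subset openin_topspace subset_antisym)
qed

lemma topspace_rips_complex:
  "topspace (rips_complex Z E n) = {\<mu> \<in> finite_prob Z. set_pmf \<mu> \<times> set_pmf \<mu> \<subseteq> E n}"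
  by (auto simp: rips_complex_def)

lemma sigma_carrier_rips_complex:
  assumes "coarse_structure Z \<E>" "generating_sequence \<E> E"
  shows "sigma_carrier (rips_complex Z E) = finite_prob Z"
proof -
  have "\<exists>n. set_pmf \<mu> \<times> set_pmf \<mu> \<subseteq> E n" if "\<mu> \<in> finite_prob Z" for \<mu>
  proof -
    have "set_pmf \<mu> \<times> set_pmf \<mu> \<in> \<E>"
      using that by (intro coarse_structure.finite_entourage[OF assms(1)])
        (auto simp: finite_prob_def)
    then show ?thesis using assms(2) by (auto simp: generating_sequence_def)
  qed
  then show ?thesis
    by (auto simp: sigma_carrier_def topspace_rips_complex)
qed

lemma continuous_map_coordinate_simplex:
  "continuous_map (simplex_topology F) euclideanreal (\<lambda>\<mu>. pmf \<mu> x)"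
proof -
  have "continuous_map euclidean euclideanreal (\<lambda>f::'a \<Rightarrow> real. f x)"
    by (simp add: continuous_on_product_coordinates)
  from continuous_map_pullback[OF this, of "{\<mu>. set_pmf \<mu> \<subseteq> F}" pmf]
  show ?thesis by (simp add: simplex_topology_def o_def)
qed

lemma continuous_map_coordinate:
  "continuous_map (prob_complex Z) euclideanreal (\<lambda>\<mu>. pmf \<mu> x)"
  unfolding continuous_map_def
proof (intro conjI allI impI)
  fix V :: "real set" assume V: "openin euclideanreal V"
  have "openin (simplex_topology F)
      ({\<mu> \<in> finite_prob Z. pmf \<mu> x \<in> V} \<inter> {\<mu>. set_pmf \<mu> \<subseteq> F})" if "finite F" "F \<subseteq> Z" for F
  proof -
    have "{\<mu> \<in> finite_prob Z. pmf \<mu> x \<in> V} \<inter> {\<mu>. set_pmf \<mu> \<subseteq> F}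
        = {\<mu> \<in> topspace (simplex_topology F). pmf \<mu> x \<in> V}"
      using that by (auto simp: finite_prob_def intro: finite_subset)
    then show ?thesis
      using openin_continuous_map_preimage[OF continuous_map_coordinate_simplex V] by simp
  qed
  then show "openin (prob_complex Z) {\<mu> \<in> topspace (prob_complex Z). pmf \<mu> x \<in> V}"
    by (auto simp: openin_prob_complex)
qed auto

lemma Hausdorff_prob_complex: "Hausdorff_space (prob_complex Z)"
  unfolding Hausdorff_space_def
proof (intro allI impI; elim conjE)
  fix \<mu> \<nu> assume mem: "\<mu> \<in> topspace (prob_complex Z)" "\<nu> \<in> topspace (prob_complex Z)"
    and "\<mu> \<noteq> \<nu>"
  then obtain x where "pmf \<mu> x \<noteq> pmf \<nu> x" by (meson pmf_eqI)
  then obtain U V where UV: "open U" "open V" "pmf \<mu> x \<in> U" "pmf \<nu> x \<in> V" "U \<inter> V = {}"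
    using hausdorff[of "pmf \<mu> x" "pmf \<nu> x"] by metis
  let ?P = "\<lambda>W. {\<mu> \<in> topspace (prob_complex Z). pmf \<mu> x \<in> W}"
  have "openin (prob_complex Z) (?P U)" "openin (prob_complex Z) (?P V)"
    using UV by (simp_all only: openin_continuous_map_preimage[OF continuous_map_coordinate] open_openin)
  moreover have "\<mu> \<in> ?P U" "\<nu> \<in> ?P V" "disjnt (?P U) (?P V)"
    using UV mem by (simp, simp) (use UV(5) in \<open>unfold disjnt_def, blast\<close>)
  ultimately show "\<exists>U V. openin (prob_complex Z) U \<and> openin (prob_complex Z) V \<and>
      \<mu> \<in> U \<and> \<nu> \<in> V \<and> disjnt U V"
    by (intro exI conjI)
qed

lemma compact_space_simplex:
  assumes "finite F"
  shows "compact_space (simplex_topology F)"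
proof -
  define S where "S = {f :: 'a \<Rightarrow> real. (\<forall>x. 0 \<le> f x) \<and> (\<forall>x. x \<notin> F \<longrightarrow> f x = 0) \<and> sum f F = 1}"
  define B where "B = (\<lambda>x. if x \<in> F then {0..1::real} else {0})"
  have "compactin (product_topology (\<lambda>x. euclidean) UNIV) (PiE UNIV B)"
    by (auto simp: compactin_PiE B_def)
  then have "compact (PiE UNIV B)"
    by (simp add: euclidean_product_topology)
  moreover have "closed S"
  proof -
    have "S = (\<Inter>x. {f. 0 \<le> f x}) \<inter> (\<Inter>x\<in>-F. {f. f x = 0}) \<inter> {f. sum f F = 1}"
      by (auto simp: S_def)
    moreover have "closed (\<Inter>x. {f :: 'a \<Rightarrow> real. 0 \<le> f x})" 
      by (intro closed_INT ballI closed_Collect_le continuous_intros continuous_on_product_coordinates)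
    moreover have "closed (\<Inter>x\<in>-F. {f :: 'a \<Rightarrow> real. f x = 0})"
      by (intro closed_INT ballI closed_Collect_eq continuous_intros continuous_on_product_coordinates)
    moreover have "closed {f :: 'a \<Rightarrow> real. sum f F = 1}"
      by (intro closed_Collect_eq continuous_intros continuous_on_product_coordinates)
    ultimately show ?thesis by (simp add: closed_Int)
  qed
  moreover have "S \<subseteq> PiE UNIV B"
  proof
    fix f assume f: "f \<in> S"
    have "f x \<le> 1" if "x \<in> F" for x
      using member_le_sum[of x F f] that f assms by (auto simp: S_def)
    then show "f \<in> PiE UNIV B" using f by (auto simp: S_def B_def)
  qed
  ultimately have "compact S"
    by (metis compact_Int_closed inf.absorb_iff2)
  have pmf_S: "pmf \<mu> \<in> S \<longleftrightarrow> set_pmf \<mu> \<subseteq> F" for \<mu>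
  proof
    assume "pmf \<mu> \<in> S"
    then show "set_pmf \<mu> \<subseteq> F" by (auto simp: S_def pmf_eq_0_set_pmf)
  next
    assume "set_pmf \<mu> \<subseteq> F"
    then show "pmf \<mu> \<in> S"
      using assms by (auto simp: S_def pmf_eq_0_set_pmf sum_pmf_eq_1)
  qed
  have emb: "pmf (embed_pmf f) = f" if "f \<in> S" for f
  proof -
    have "(\<integral>\<^sup>+x. ennreal (f x) \<partial>count_space UNIV) = (\<Sum>x\<in>F. ennreal (f x))"
      using that assms by (intro nn_integral_count_space') (auto simp: S_def)
    also have "\<dots> = ennreal (\<Sum>x\<in>F. f x)"
      using that by (intro sum_ennreal) (auto simp: S_def)
    finally show ?thesis
      using that by (intro ext pmf_embed_pmf) (auto simp: S_def)
  qed
  have set_emb: "set_pmf (embed_pmf f) \<subseteq> F" if "f \<in> S" for f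
    using emb[OF that] pmf_S[of "embed_pmf f"] that by simp
  have "continuous_map (top_of_set S) (simplex_topology F) embed_pmf"
    unfolding simplex_topology_def
  proof (rule continuous_map_pullback')
    show "continuous_map (top_of_set S) euclidean (pmf \<circ> embed_pmf)"
      by (rule continuous_map_eq[of _ _ id]) (auto simp: emb)
    show "topspace (top_of_set S) \<subseteq> embed_pmf -` {\<mu>. set_pmf \<mu> \<subseteq> F}"
      using set_emb by auto
  qed
  then have "compactin (simplex_topology F) (embed_pmf ` S)"
    using \<open>compact S\<close> by (intro image_compactin[where X = "top_of_set S"])
      (auto simp: compactin_subtopology)
  moreover have "embed_pmf ` S = topspace (simplex_topology F)"
  proof
    show "embed_pmf ` S \<subseteq> topspace (simplex_topology F)" using set_emb by auto
    show "topspace (simplex_topology F) \<subseteq> embed_pmf ` S"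
    proof
      fix \<mu> assume "\<mu> \<in> topspace (simplex_topology F)"
      then have "pmf \<mu> \<in> S" by (simp add: pmf_S)
      moreover have "embed_pmf (pmf \<mu>) = \<mu>"
        using emb[OF \<open>pmf \<mu> \<in> S\<close>] by (metis pmf_eqI)
      ultimately show "\<mu> \<in> embed_pmf ` S" by (metis imageI)
    qed
  qed
  ultimately show ?thesis by (simp only: compact_space_def)
qed

lemma compactin_simplex:
  assumes "finite F" "F \<subseteq> Z"
  shows "compactin (prob_complex Z) {\<mu>. set_pmf \<mu> \<subseteq> F}"
proof -
  have "continuous_map (simplex_topology F) (prob_complex Z) id"
    unfolding continuous_map_def
  proof (intro conjI allI impI)
    show "id \<in> topspace (simplex_topology F) \<rightarrow> topspace (prob_complex Z)"
      using assms by (auto simp: finite_prob_def intro: finite_subset[OF _ assms(1)])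
    fix U assume "openin (prob_complex Z) U"
    then have "openin (simplex_topology F) (U \<inter> {\<mu>. set_pmf \<mu> \<subseteq> F})"
      using assms by (auto simp: openin_prob_complex)
    then show "openin (simplex_topology F) {\<mu> \<in> topspace (simplex_topology F). id \<mu> \<in> U}"
      by (simp add: Int_def conj_commute)
  qed
  from image_compactin[OF compact_space_simplex[OF assms(1), unfolded compact_space_def] this]
  show ?thesis by simp
qed

lemma closedin_coordinate_zero:
  "closedin (prob_complex Z) {\<mu> \<in> finite_prob Z. pmf \<mu> x = 0}"
proof -
  have "closedin (prob_complex Z) {\<mu> \<in> topspace (prob_complex Z). pmf \<mu> x \<in> {0}}"
    by (rule closedin_continuous_map_preimage[OF continuous_map_coordinate]) simp
  then show ?thesis by (simp only: topspace_prob_complex singleton_iff)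
qed

lemma closedin_rips:
  "closedin (prob_complex Z) {\<mu> \<in> finite_prob Z. set_pmf \<mu> \<times> set_pmf \<mu> \<subseteq> e}"
proof -
  have "set_pmf \<mu> \<times> set_pmf \<mu> \<subseteq> e \<longleftrightarrow>
      (\<forall>p\<in>-e. pmf \<mu> (fst p) = 0 \<or> pmf \<mu> (snd p) = 0)" (is "?L \<longleftrightarrow> ?R") for \<mu>
  proof
    show ?R if ?L
    proof
      fix p assume "p \<in> -e"
      with that have "p \<notin> set_pmf \<mu> \<times> set_pmf \<mu>" by blast
      then show "pmf \<mu> (fst p) = 0 \<or> pmf \<mu> (snd p) = 0"
        by (simp only: pmf_eq_0_set_pmf mem_Times_iff de_Morgan_conj)
    qed
    show ?L if ?R
    proof
      fix p assume "p \<in> set_pmf \<mu> \<times> set_pmf \<mu>"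
      then have "pmf \<mu> (fst p) \<noteq> 0" "pmf \<mu> (snd p) \<noteq> 0"
        by (simp_all only: pmf_eq_0_set_pmf mem_Times_iff not_not)
      with that show "p \<in> e" by blast
    qed
  qed
  then have "{\<mu> \<in> finite_prob Z. set_pmf \<mu> \<times> set_pmf \<mu> \<subseteq> e} = finite_prob Z \<inter>
      (\<Inter>p\<in>-e. {\<mu> \<in> finite_prob Z. pmf \<mu> (fst p) = 0} \<union> {\<mu> \<in> finite_prob Z. pmf \<mu> (snd p) = 0})"
    by (simp only:) blast
  also have "closedin (prob_complex Z) \<dots>"
  proof (cases "-e = {}")
    case True
    show ?thesis unfolding True using closedin_topspace[of "prob_complex Z"] by simp
  next
    case False
    have "closedin (prob_complex Z) (finite_prob Z)"
      using closedin_topspace[of "prob_complex Z"] by simp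
    with False show ?thesis
      by (intro closedin_Int closedin_INT closedin_Un closedin_coordinate_zero)
  qed
  finally show ?thesis .
qed

lemma (in discrete_coarse_space) finite_section:
  assumes "e \<in> \<E>"
  shows "finite (e `` {x})"
proof -
  have "e\<inverse> O e \<in> \<E>" using assms by (intro comp_closed converse_closed)
  then have "(e `` {x}) \<times> (e `` {x}) \<in> \<E>"
    by (rule subset_closed) auto
  moreover have sub: "e `` {x} \<subseteq> topspace T" using entourage_subset[OF assms] by auto
  ultimately have "compactin T (T closure_of (e `` {x}))"
    by (intro bounded_relatively_compact) (simp add: coarsely_bounded_def)
  then have "finite (T closure_of (e `` {x}))"
    using arg_cong[OF discrete, of "\<lambda>T'. compactin T' (T closure_of (e `` {x}))"]
    by (simp add: compactin_discrete_topology)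
  then show ?thesis by (meson closure_of_subset finite_subset sub)
qed

lemma (in discrete_coarse_space) sigma_locally_compact_rips_complex:
  assumes "generating_sequence \<E> E"
  shows "sigma_locally_compact (rips_complex (topspace T) E)"
  unfolding sigma_locally_compact_def
proof (intro conjI allI impI)
  let ?Z = "topspace T"
  let ?A = "\<lambda>n. {\<mu> \<in> finite_prob ?Z. set_pmf \<mu> \<times> set_pmf \<mu> \<subseteq> E n}"
  fix n
  show "Hausdorff_space (rips_complex ?Z E n)"
    by (simp add: rips_complex_def Hausdorff_space_subtopology Hausdorff_prob_complex)
  show "locally_compact_space (rips_complex ?Z E n)"
    unfolding locally_compact_space_def
  proof
    fix \<mu> assume \<mu>: "\<mu> \<in> topspace (rips_complex ?Z E n)"
    obtain x where x: "x \<in> set_pmf \<mu>" using set_pmf_not_empty by fast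
    define F where "F = E n `` {x}"
    have En: "E n \<in> \<E>" using assms by (simp add: generating_sequence_def)
    have F: "finite F" "F \<subseteq> ?Z"
      using finite_section[OF En] entourage_subset[OF En] by (auto simp: F_def)
    define U where "U = {\<nu> \<in> topspace (rips_complex ?Z E n). pmf \<nu> x \<in> {0<..}}"
    have "continuous_map (rips_complex ?Z E n) euclideanreal (\<lambda>\<nu>. pmf \<nu> x)"
      unfolding rips_complex_def
      by (intro continuous_map_from_subtopology continuous_map_coordinate)
    then have "openin (rips_complex ?Z E n) U"
      unfolding U_def by (rule openin_continuous_map_preimage) simp
    moreover have "compactin (prob_complex ?Z) (?A n \<inter> {\<nu>. set_pmf \<nu> \<subseteq> F})"
      by (intro closed_Int_compactin closedin_rips compactin_simplex F)
    then have "compactin (rips_complex ?Z E n) (?A n \<inter> {\<nu>. set_pmf \<nu> \<subseteq> F})"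
      by (simp add: rips_complex_def compactin_subtopology)
    moreover have "\<mu> \<in> U" using \<mu> x by (simp add: U_def pmf_positive)
    moreover have "U \<subseteq> ?A n \<inter> {\<nu>. set_pmf \<nu> \<subseteq> F}"
      by (auto simp: U_def topspace_rips_complex F_def pmf_positive_iff)
    ultimately show "\<exists>U K. openin (rips_complex ?Z E n) U \<and> compactin (rips_complex ?Z E n) K \<and>
        \<mu> \<in> U \<and> U \<subseteq> K"
      by blast
  qed
next
  let ?Z = "topspace T"
  let ?A = "\<lambda>n. {\<mu> \<in> finite_prob ?Z. set_pmf \<mu> \<times> set_pmf \<mu> \<subseteq> E n}"
  fix n m :: nat assume "n \<le> m"
  then have "E n \<subseteq> E m"
    using assms by (auto simp: generating_sequence_def incseq_def)
  then have sub: "?A n \<subseteq> ?A m" by blast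
  show "closedin (rips_complex ?Z E m) (topspace (rips_complex ?Z E n))"
    unfolding topspace_rips_complex unfolding rips_complex_def
    using sub by (intro closedin_subset_topspace closedin_rips) 
  show "rips_complex ?Z E n = subtopology (rips_complex ?Z E m) (topspace (rips_complex ?Z E n))"
    unfolding topspace_rips_complex unfolding rips_complex_def
    using sub by (simp add: subtopology_subtopology Int_absorb1)
qed

end

theory Submission
  imports Defs
begin

text \<open>Push measures forward along \<open>h\<^sub>n = H(-, n)\<close> and interpolate affinely between consecutive
  \<open>n\<close>, at time \<open>s = t / (1 - t)\<close>. Measures supported in a common \<open>E\<^sub>n\<close>-ball are supported in one
  bounded, hence finite, set, on which all but finitely many \<open>h\<^sub>n\<close> are constantly \<open>pt\<close>; so locally
  the homotopy takes values in a single finite simplex, it extends continuously to \<open>t = 1\<close>, and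
  continuity can be checked in barycentric coordinates. That it preserves the filtration is the
  coarseness of \<open>H\<close> applied to \<open>E\<^sub>n\<close> and \<open>|i - j| \<le> 1\<close>.\<close>

section \<open>Interpolation weights on the half-line\<close>

text \<open>Random rounding of \<open>s\<close> to a neighbouring integer, with mean
  \<open>s\<close> for \<open>s \<ge> 0\<close>. Encoding the affine interpolation as a
  \<open>pmf\<close> lets \<open>bind_pmf\<close> do the averaging, so the result is a probability
  measure by construction.\<close>

definition tent_pmf :: "real \<Rightarrow> nat pmf" where
  "tent_pmf s = map_pmf (\<lambda>b. if b then Suc (nat \<lfloor>s\<rfloor>) else nat \<lfloor>s\<rfloor>) (bernoulli_pmf (frac s))"

lemma set_tent_pmf: "set_pmf (tent_pmf s) \<subseteq> {nat \<lfloor>s\<rfloor>, Suc (nat \<lfloor>s\<rfloor>)}"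
  by (auto simp: tent_pmf_def)

text \<open>The hat-function form makes continuity in \<open>s\<close> visible, which floor and
  fractional part hide.\<close>

lemma pmf_tent_pmf:
  assumes "s \<ge> 0"
  shows "pmf (tent_pmf s) n = max 0 (1 - \<bar>s - real n\<bar>)"
proof -
  define k where "k = nat \<lfloor>s\<rfloor>"
  have k: "s = real k + frac s" using assms by (simp add: k_def frac_def)
  have fr: "0 \<le> frac s" "frac s < 1" by (simp_all add: frac_lt_1)
  have "pmf (tent_pmf s) n =
      pmf (return_pmf (Suc k)) n * frac s + pmf (return_pmf k) n * (1 - frac s)"
    using fr by (simp add: tent_pmf_def map_pmf_def pmf_bind k_def less_imp_le)
  also have "\<dots> = max 0 (1 - \<bar>s - real n\<bar>)"
  proof -
    consider "n < k" | "n = k" | "n = Suc k" | "n > Suc k" by linarith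
    then show ?thesis
    proof cases
      case 1
      then have "\<bar>s - real n\<bar> \<ge> 1" using k fr by linarith
      then show ?thesis using 1 by (simp add: indicator_def max_absorb1)
    next
      case 4
      then have "\<bar>s - real n\<bar> \<ge> 1" using k fr by linarith
      then show ?thesis using 4 by (simp add: indicator_def max_absorb1)
    next
      case 2
      then have "s - real n = frac s" using k by linarith
      then show ?thesis using 2 fr by simp
    next
      case 3
      then have "s - real n = frac s - 1" using k by simp
      then show ?thesis using 3 fr by simp
    qed
  qed
  finally show ?thesis .
qed

lemma tent_pmf_0 [simp]: "tent_pmf 0 = return_pmf 0"
  by (rule pmf_eqI) (auto simp: pmf_tent_pmf indicator_def max_absorb1)

text \<open>The value \<open>0\<close> at \<open>t = 1\<close> is the limit; \<open>t / (1 - t)\<close> itself is \<open>0\<close> there.\<close>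

definition tent :: "nat \<Rightarrow> real \<Rightarrow> real" where
  "tent n t = (if t < 1 then pmf (tent_pmf (t / (1 - t))) n else 0)"

lemma continuous_on_tent: "continuous_on {0..1} (tent n)"
proof -
  \<comment> \<open>The time at which \<open>t / (1 - t) = n + 1\<close>: from there on the hat
    function at \<open>n\<close> vanishes, and up to there \<open>1 - t\<close> stays away from
    \<open>0\<close>.\<close>
  define b where "b = (real n + 1) / (real n + 2)"
  have b: "0 \<le> b" "b < 1" by (simp_all add: b_def)
  have "continuous_on {0..b} (tent n)"
  proof (rule continuous_on_eq)
    show "continuous_on {0..b} (\<lambda>t. max 0 (1 - \<bar>t / (1 - t) - real n\<bar>))"
      using b by (intro continuous_intros) auto
    show "max 0 (1 - \<bar>t / (1 - t) - real n\<bar>) = tent n t" if "t \<in> {0..b}" for t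
      using that b by (simp add: tent_def pmf_tent_pmf)
  qed
  moreover have "continuous_on {b..1} (tent n)"
  proof (rule continuous_on_eq)
    show "0 = tent n t" if "t \<in> {b..1}" for t
    proof (cases "t < 1")
      case True
      have "real n + 1 \<le> t / (1 - t)"
        using that True by (simp add: b_def field_simps)
      then show ?thesis using True that b by (simp add: tent_def pmf_tent_pmf)
    qed (simp add: tent_def)
  qed simp
  ultimately have "continuous_on ({0..b} \<union> {b..1}) (tent n)"
    by (intro continuous_on_closed_Un) auto
  moreover have "{0..b} \<union> {b..1} = {0..1}" using b by auto
  ultimately show ?thesis by simp
qed

section \<open>The homotopy in barycentric coordinates\<close>

text \<open>Summing over a fixed \<open>F\<close> instead of the support of \<mu> gives an
  expression that is linear in the coordinates of \<mu>.\<close>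

lemma pmf_map_finite_support:
  assumes "finite F" "set_pmf \<mu> \<subseteq> F"
  shows "pmf (map_pmf f \<mu>) z = (\<Sum>x\<in>F. pmf (return_pmf (f x)) z * pmf \<mu> x)"
  unfolding map_pmf_def pmf_bind using assms
  by (intro integral_measure_pmf_real) auto

text \<open>As \<open>K\<close> has mass \<open>1\<close>, subtracting the eventual value \<nu>
  leaves an integrand that vanishes from \<open>N\<close> on. The range of summation then depends on
  \<open>N\<close> only, not on \<open>K\<close>.\<close>

lemma pmf_bind_eventually_const:
  fixes K :: "nat pmf"
  assumes "finite (set_pmf K)" "\<And>n. n \<ge> N \<Longrightarrow> f n = \<nu>"
  shows "pmf (bind_pmf K f) z = pmf \<nu> z + (\<Sum>n<N. (pmf (f n) z - pmf \<nu> z) * pmf K n)"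
proof -
  have "(\<Sum>n<N. (pmf (f n) z - pmf \<nu> z) * pmf K n) = (\<integral>n. pmf (f n) z - pmf \<nu> z \<partial>measure_pmf K)"
  proof (rule integral_measure_pmf_real[symmetric])
    show "n \<in> {..<N}" if "pmf (f n) z - pmf \<nu> z \<noteq> 0" for n
      using that assms(2)[of n] by (cases "N \<le> n") auto
  qed simp
  also have "\<dots> = pmf (bind_pmf K f) z - pmf \<nu> z"
    using assms(1) by (simp add: pmf_bind Bochner_Integration.integral_diff integrable_measure_pmf_finite)
  finally show ?thesis by simp
qed

text \<open>The case split matters: at \<open>t = 1\<close> the quotient \<open>t / (1 - t)\<close>
  is \<open>0\<close>, which would give the push-forward for \<open>n = 0\<close> instead of the
  limit.\<close>

definition rips_homotopy :: "('a \<times> nat \<Rightarrow> 'a) \<Rightarrow> 'a \<Rightarrow> 'a pmf \<times> real \<Rightarrow> 'a pmf" where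
  "rips_homotopy H pt = (\<lambda>(\<mu>, t). if t < 1
     then bind_pmf (tent_pmf (t / (1 - t))) (\<lambda>n. map_pmf (\<lambda>x. H (x, n)) \<mu>) else return_pmf pt)"

text \<open>One formula covers the end as well, since \<open>tent n 1 = 0\<close>. As
  \<open>N\<close> is uniform over \<open>F\<close>, each coordinate is a finite sum of products of
  functions continuous in \<mu> and in \<open>t\<close>.\<close>

lemma pmf_rips_homotopy:
  assumes "finite F" "set_pmf \<mu> \<subseteq> F" "\<And>x n. x \<in> F \<Longrightarrow> n \<ge> N \<Longrightarrow> H (x, n) = pt"
  shows "pmf (rips_homotopy H pt (\<mu>, t)) z = pmf (return_pmf pt) z +
    (\<Sum>n<N. ((\<Sum>x\<in>F. pmf (return_pmf (H (x, n))) z * pmf \<mu> x) - pmf (return_pmf pt) z) * tent n t)"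
proof (cases "t < 1")
  case True
  have "map_pmf (\<lambda>x. H (x, n)) \<mu> = return_pmf pt" if "n \<ge> N" for n
  proof -
    have "map_pmf (\<lambda>x. H (x, n)) \<mu> = map_pmf (\<lambda>x. pt) \<mu>"
      using assms that by (intro map_pmf_cong) auto
    then show ?thesis by simp
  qed
  moreover have "finite (set_pmf (tent_pmf (t / (1 - t))))"
    using finite_subset[OF set_tent_pmf] by blast
  ultimately show ?thesis
    using True pmf_bind_eventually_const[where f = "\<lambda>n. map_pmf (\<lambda>x. H (x, n)) \<mu>"
      and K = "tent_pmf (t / (1 - t))" and N = N and \<nu> = "return_pmf pt" and z = z]
    unfolding pmf_map_finite_support[OF assms(1,2)] by (simp add: rips_homotopy_def tent_def)
qed (simp add: rips_homotopy_def tent_def)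

text \<open>Openness in the weak topology is tested on closed simplices.\<close>

lemma continuous_map_simplex_prob_complex:
  assumes "finite F" "F \<subseteq> Z"
  shows "continuous_map (simplex_topology F) (prob_complex Z) id"
  unfolding continuous_map_def
proof (intro conjI allI impI)
  show "id \<in> topspace (simplex_topology F) \<rightarrow> topspace (prob_complex Z)"
    using assms by (auto simp: finite_prob_def intro: finite_subset[OF _ assms(1)])
  fix U assume "openin (prob_complex Z) U"
  then have "openin (simplex_topology F) (U \<inter> {\<mu>. set_pmf \<mu> \<subseteq> F})"
    using assms by (auto simp: openin_prob_complex)
  then show "openin (simplex_topology F) {\<mu> \<in> topspace (simplex_topology F). id \<mu> \<in> U}"
    by (simp add: Int_def conj_commute)
qed

text \<open>On one finite simplex the topology is that of the coordinates. On the whole complex the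
  weak topology may be finer, hence the common \<open>F\<close>.\<close>

lemma continuous_map_into_prob_complex:
  assumes "finite F" "F \<subseteq> Z" "\<And>p. p \<in> topspace X \<Longrightarrow> set_pmf (f p) \<subseteq> F"
    and "\<And>z. continuous_map X euclideanreal (\<lambda>p. pmf (f p) z)"
  shows "continuous_map X (prob_complex Z) f"
proof -
  have "continuous_map X euclidean (pmf \<circ> f)"
    using assms(4) unfolding euclidean_product_topology[symmetric]
    by (simp add: continuous_map_componentwise_UNIV)
  then have "continuous_map X (simplex_topology F) f"
    unfolding simplex_topology_def using assms(3) by (intro continuous_map_pullback') auto
  from continuous_map_compose[OF this continuous_map_simplex_prob_complex[OF assms(1,2)]]
  show ?thesis by simp
qed

lemma (in coarse_structure) coarsely_bounded_finite:
  assumes "finite B" "B \<subseteq> X"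
  shows "coarsely_bounded X \<E> B"
  using assms unfolding coarsely_bounded_def by (auto intro!: finite_entourage)

text \<open>Only two consecutive push-forwards are mixed at any time, so indices in the support
  differ by at most \<open>1\<close>.\<close>

lemma set_rips_homotopy:
  assumes "0 \<le> t"
  obtains k where "set_pmf (rips_homotopy H pt (\<mu>, t)) \<subseteq> H ` (set_pmf \<mu> \<times> {k, Suc k}) \<or>
     rips_homotopy H pt (\<mu>, t) = return_pmf pt"
proof (cases "t < 1")
  case True
  show ?thesis
    using True set_tent_pmf[of "t / (1 - t)"]
    by (intro that[of "nat \<lfloor>t / (1 - t)\<rfloor>"] disjI1) (fastforce simp: rips_homotopy_def)
qed (auto intro: that simp: rips_homotopy_def)

section \<open>Filtration and continuity\<close>

context discrete_coarse_space
begin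

lemma rips_homotopy_pieces:
  assumes E: "generating_sequence \<E> E" and H: "coarse_contraction T \<E> pt H"
  shows "\<exists>m\<ge>n. rips_homotopy H pt ` (topspace (rips_complex (topspace T) E n) \<times> {0..1})
     \<subseteq> topspace (rips_complex (topspace T) E m)"
proof -
  define e where "e = {((x, i), (y, j)). (x, y) \<in> E n \<and> \<bar>real i - real j\<bar> \<le> 1}"
  have En: "E n \<in> \<E>" using E by (simp add: generating_sequence_def)
  have "{(i, j). \<bar>real i - real j\<bar> \<le> 1} \<in> nat_coarse_structure"
    by (auto simp: nat_coarse_structure_def dist_real_def)
  then have "e \<in> product_coarse_structure \<E> nat_coarse_structure"
    unfolding product_coarse_structure_def mem_Collect_eq
    by (intro bexI[OF _ En] bexI[of _ "{(i, j). \<bar>real i - real j\<bar> \<le> 1}"]) (auto simp: e_def)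
  then have "map_prod H H ` e \<in> \<E>" using H by (auto simp: coarse_contraction_def)
  moreover have pt: "pt \<in> topspace T" using H by (simp add: coarse_contraction_def)
  \<comment> \<open>This pair accounts for the Dirac measure at \<open>pt\<close>, reached at
    \<open>t = 1\<close>.\<close>
  then have "{(pt, pt)} \<in> \<E>" by (intro finite_entourage) auto
  ultimately have "map_prod H H ` e \<union> {(pt, pt)} \<in> \<E>" by (rule union_closed)
  then obtain m0 where m0: "map_prod H H ` e \<union> {(pt, pt)} \<subseteq> E m0"
    using E by (meson generating_sequence_def)
  define m where "m = max n m0"
  have "E m0 \<subseteq> E m" using E by (simp add: generating_sequence_def incseq_def m_def)
  with m0 have m: "map_prod H H ` e \<subseteq> E m" "(pt, pt) \<in> E m" by auto
  have Em: "E m \<in> \<E>" using E by (simp add: generating_sequence_def)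
  have "rips_homotopy H pt (\<mu>, t) \<in> topspace (rips_complex (topspace T) E m)"
    if \<mu>: "\<mu> \<in> topspace (rips_complex (topspace T) E n)" and t: "0 \<le> t" for \<mu> t
  proof -
    have fin: "finite (set_pmf \<mu>)" and En: "set_pmf \<mu> \<times> set_pmf \<mu> \<subseteq> E n"
      using \<mu> by (auto simp: topspace_rips_complex finite_prob_def)
    let ?S = "set_pmf (rips_homotopy H pt (\<mu>, t))"
    have "?S \<times> ?S \<subseteq> E m \<and> finite ?S"
    proof (rule set_rips_homotopy[OF t, of H pt \<mu>], elim disjE)
      fix k assume S: "?S \<subseteq> H ` (set_pmf \<mu> \<times> {k, Suc k})"
      have "?S \<times> ?S \<subseteq> map_prod H H ` ((set_pmf \<mu> \<times> {k, Suc k}) \<times> (set_pmf \<mu> \<times> {k, Suc k}))"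
        using S by (fastforce simp: map_prod_surj_on)
      also have "\<dots> \<subseteq> map_prod H H ` e"
        using En by (intro image_mono) (auto simp: e_def)
      finally show ?thesis using S fin m(1) by (auto intro: finite_subset)
    qed (use m in simp)
    \<comment> \<open>Entourages lie over the space, so the diagonal pairs of
      \<open>?S \<times> ?S\<close> place \<open>?S\<close> inside it.\<close>
    moreover from this have "?S \<subseteq> topspace T" using entourage_subset[OF Em] by blast
    ultimately show ?thesis by (simp add: topspace_rips_complex finite_prob_def)
  qed
  then show ?thesis by (intro exI[of _ m]) (auto simp: m_def)
qed

lemma continuous_map_rips_homotopy:
  assumes E: "generating_sequence \<E> E" and H: "coarse_contraction T \<E> pt H"
  shows "continuous_map (prod_topology (rips_complex (topspace T) E n) (top_of_set {0..1}))
     (prob_complex (topspace T)) (rips_homotopy H pt)"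
proof -
  let ?Z = "topspace T"
  let ?X = "prod_topology (rips_complex ?Z E n) (top_of_set {0..1::real})"
  \<comment> \<open>The open star of the vertex \<open>x\<close> in the \<open>n\<close>-th piece,
    times the interval.\<close>
  define U where "U x = {\<nu> \<in> topspace (rips_complex ?Z E n). pmf \<nu> x \<in> {0<..}} \<times> {0..1::real}" for x
  have En: "E n \<in> \<E>" using E by (simp add: generating_sequence_def)
  have coord: "continuous_map ?X euclideanreal (\<lambda>p. pmf (fst p) x)" for x
    using continuous_map_compose[OF continuous_map_fst
      continuous_map_from_subtopology[OF continuous_map_coordinate]]
    by (simp add: rips_complex_def o_def)
  have tent: "continuous_map ?X euclideanreal (\<lambda>p. tent k (snd p))" for k
    using continuous_map_compose[OF continuous_map_snd, of "top_of_set {0..1}" euclideanreal "tent k"]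
      continuous_on_tent by (simp add: o_def)
  have cov: "\<exists>x. p \<in> U x" if "p \<in> topspace ?X" for p
  proof -
    obtain x where "x \<in> set_pmf (fst p)" using set_pmf_not_empty by fast
    then show ?thesis using that by (intro exI[of _ x]) (auto simp: U_def pmf_positive)
  qed
  have op: "openin ?X (U x)" for x
  proof -
    have "openin ?X {p \<in> topspace ?X. pmf (fst p) x \<in> {0<..}}"
      by (rule openin_continuous_map_preimage[OF coord]) simp
    moreover have "{p \<in> topspace ?X. pmf (fst p) x \<in> {0<..}} = U x"
      by (auto simp: U_def)
    ultimately show ?thesis by simp
  qed
  have cont: "continuous_map (subtopology ?X (U x)) (prob_complex ?Z) (rips_homotopy H pt)" for x
  proof -
    \<comment> \<open>A measure in the \<open>n\<close>-th piece charging \<open>x\<close> is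
      supported in this ball, because all pairs of its support lie in \<open>E n\<close>.\<close>
    define F where "F = E n `` {x}"
    have F: "finite F" "F \<subseteq> ?Z"
      using finite_section[OF En] entourage_subset[OF En] by (auto simp: F_def)
    obtain N where N: "\<And>y k. y \<in> F \<Longrightarrow> k \<ge> N \<Longrightarrow> H (y, k) = pt"
      using H coarsely_bounded_finite[OF F] unfolding coarse_contraction_def by meson
    have supp: "set_pmf (fst p) \<subseteq> F" if "p \<in> U x" for p
      using that by (auto simp: U_def topspace_rips_complex F_def pmf_positive_iff)
    show ?thesis
    proof (rule continuous_map_into_prob_complex)
      \<comment> \<open>Indices from \<open>N\<close> on contribute only \<open>pt\<close>, which
        makes the set of values finite. Intersecting with \<open>?Z\<close> loses no support points,
        by \<open>rips_homotopy_pieces\<close>.\<close>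
      define G where "G = insert pt (H ` (F \<times> {..<N})) \<inter> ?Z"
      show "finite G" "G \<subseteq> ?Z" using F by (auto simp: G_def)
      fix p assume "p \<in> topspace (subtopology ?X (U x))"
      then have p: "p \<in> U x" "fst p \<in> topspace (rips_complex ?Z E n)" "snd p \<in> {0..1}" by auto
      obtain m where "rips_homotopy H pt ` (topspace (rips_complex ?Z E n) \<times> {0..1})
          \<subseteq> topspace (rips_complex ?Z E m)"
        using rips_homotopy_pieces[OF E H] by blast
      then have "rips_homotopy H pt p \<in> topspace (rips_complex ?Z E m)"
        using p by (metis image_subset_iff mem_Times_iff)
      then have "set_pmf (rips_homotopy H pt p) \<subseteq> ?Z"
        by (auto simp: topspace_rips_complex finite_prob_def)
      moreover obtain k where "set_pmf (rips_homotopy H pt p) \<subseteq> H ` (set_pmf (fst p) \<times> {k, Suc k}) \<or>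
          rips_homotopy H pt p = return_pmf pt"
        using set_rips_homotopy[of "snd p" H pt "fst p"] p by auto
      then have "set_pmf (rips_homotopy H pt p) \<subseteq> insert pt (H ` (F \<times> {..<N}))"
        using supp[OF p(1)] N by (fastforce simp: not_less[symmetric])
      ultimately show "set_pmf (rips_homotopy H pt p) \<subseteq> G" by (simp add: G_def)
    next
      fix z
      have "continuous_map (subtopology ?X (U x)) euclideanreal (\<lambda>p. pmf (return_pmf pt) z +
          (\<Sum>n<N. ((\<Sum>x\<in>F. pmf (return_pmf (H (x, n))) z * pmf (fst p) x) - pmf (return_pmf pt) z)
            * tent n (snd p)))"
        by (intro continuous_map_from_subtopology continuous_intros continuous_map_sum coord tent
            finite_lessThan F)
      then show "continuous_map (subtopology ?X (U x)) euclideanreal (\<lambda>p. pmf (rips_homotopy H pt p) z)"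
      proof (rule continuous_map_eq)
        fix p assume "p \<in> topspace (subtopology ?X (U x))"
        then have "p \<in> U x" by simp
        then show "pmf (return_pmf pt) z +
          (\<Sum>n<N. ((\<Sum>x\<in>F. pmf (return_pmf (H (x, n))) z * pmf (fst p) x) - pmf (return_pmf pt) z)
            * tent n (snd p)) = pmf (rips_homotopy H pt p) z"
          using pmf_rips_homotopy[of F "fst p" N H pt "snd p" z, OF F(1) supp N] by simp
      qed
    qed
  qed
  \<comment> \<open>The open stars cover, and the local maps are restrictions of one map, so they
    agree on overlaps.\<close>
  show ?thesis
    by (rule pasting_lemma[where I = UNIV and T = U and f = "\<lambda>_. rips_homotopy H pt"])
      (use cov in \<open>blast intro: op cont\<close>)+
qed

section \<open>Assembling the contraction\<close>

lemma sigma_contraction_rips_homotopy: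
  assumes E: "generating_sequence \<E> E" and H: "coarse_contraction T \<E> pt H"
  shows "sigma_contraction (rips_complex (topspace T) E) (return_pmf pt) (rips_homotopy H pt)"
proof -
  let ?P = "rips_complex (topspace T) E"
  have pt: "pt \<in> topspace T" "\<And>n. H (pt, n) = pt" and H0: "\<And>x. x \<in> topspace T \<Longrightarrow> H (x, 0) = x"
    using H by (simp_all add: coarse_contraction_def)
  have carrier: "sigma_carrier ?P = finite_prob (topspace T)"
    using E by (intro sigma_carrier_rips_complex) unfold_locales
  have start: "rips_homotopy H pt (\<mu>, 0) = \<mu>" if "\<mu> \<in> finite_prob (topspace T)" for \<mu>
  proof -
    have "map_pmf (\<lambda>x. H (x, 0)) \<mu> = map_pmf (\<lambda>x. x) \<mu>"
      using that H0 by (intro map_pmf_cong) (auto simp: finite_prob_def)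
    then show ?thesis by (simp add: rips_homotopy_def bind_return_pmf)
  qed
  have maps: "rips_homotopy H pt \<in> sigma_carrier ?P \<times> {0..1} \<rightarrow> sigma_carrier ?P"
  proof
    fix p assume "p \<in> sigma_carrier ?P \<times> {0..1::real}"
    then obtain n where "p \<in> topspace (?P n) \<times> {0..1}" by (auto simp: sigma_carrier_def)
    with rips_homotopy_pieces[OF E H, of n] show "rips_homotopy H pt p \<in> sigma_carrier ?P"
      unfolding sigma_carrier_def by blast
  qed
  have dirac: "return_pmf pt \<in> finite_prob (topspace T)"
    using pt by (simp add: finite_prob_def)
  have stays: "rips_homotopy H pt p = return_pmf pt"
    if "p \<in> sigma_carrier ?P \<times> {1} \<union> {return_pmf pt} \<times> {0..1}" for p
    \<comment> \<open>Each push-forward fixes the Dirac measure at \<open>pt\<close>, hence so does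
      every mixture of them.\<close>
    using that pt by (auto simp: rips_homotopy_def)
  \<comment> \<open>The image is all of the singleton only if the domain is nonempty.\<close>
  have "(return_pmf pt, 1) \<in> sigma_carrier ?P \<times> {1} \<union> {return_pmf pt} \<times> {0..1::real}"
    using dirac by (simp add: carrier)
  from image_eqI[where f = "rips_homotopy H pt", OF stays[OF this, symmetric] this]
  have ends: "rips_homotopy H pt ` (sigma_carrier ?P \<times> {1} \<union> {return_pmf pt} \<times> {0..1}) = {return_pmf pt}"
    using stays by blast
  have pieces: "\<exists>m\<ge>n. rips_homotopy H pt ` (topspace (?P n) \<times> {0..1}) \<subseteq> topspace (?P m) \<and>
      continuous_map (prod_topology (?P n) (top_of_set {0..1})) (?P m) (rips_homotopy H pt)" for n
  proof -
    obtain m where m: "m \<ge> n"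
        "rips_homotopy H pt ` (topspace (?P n) \<times> {0..1}) \<subseteq> topspace (?P m)"
      using rips_homotopy_pieces[OF E H] by blast
    \<comment> \<open>Each piece carries the subspace topology of the full complex, so the image
      inclusion upgrades continuity into the complex.\<close>
    then have "continuous_map (prod_topology (?P n) (top_of_set {0..1})) (?P m) (rips_homotopy H pt)"
      using continuous_map_rips_homotopy[OF E H, of n] m(2)
      unfolding topspace_rips_complex unfolding rips_complex_def[of _ _ m]
      by (auto simp: continuous_map_in_subtopology topspace_rips_complex)
    with m show ?thesis by blast
  qed
  show ?thesis
    unfolding sigma_contraction_def
    using dirac start maps ends pieces by (simp only: carrier) simp
qed

end

theorem theorem9p6:
  fixes Z :: "'a topology" and \<E> :: "('a \<times> 'a) set set"
    and E :: "nat \<Rightarrow> ('a \<times> 'a) set"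
  assumes "discrete_coarse_space Z \<E>"
    and "countably_generated \<E>"
    and "coarsely_contractible Z \<E>"
    and "generating_sequence \<E> E"
  shows "sigma_contractible (rips_complex (topspace Z) E)"
  using discrete_coarse_space.sigma_locally_compact_rips_complex[OF assms(1,4)]
    discrete_coarse_space.sigma_contraction_rips_homotopy[OF assms(1,4)] assms(3)
  unfolding sigma_contractible_def coarsely_contractible_def by blast

end
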